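(* Let $\mathbf{b}\in\mathbb{R}^n$ with $\mathbf{b}\ge\mathbf{0}$, and let $\mathcal{A}\in T(m,n)$ be of the form $\mathcal{A}=c\mathcal{I}-\mathcal{B}$ with $\mathcal{B}\ge 0$ and $c=\rho(\mathcal{B})+1$. If there exists a vector $\mathbf{v}\in\mathbb{R}^n$ with $\mathbf{v}\ge\mathbf{0}$ such that $(\mathcal{A}-\mathcal{I})\mathbf{v}^{m-1}\ge\mathbf{b}$, then the tensor absolute value equation $$\mathcal{A}\mathbf{x}^{m-1}-|\mathbf{x}|^{[m-1]}=\mathbf{b}$$ has a nonnegative solution $\mathbf{x}\in\mathbb{R}^n$.
   Context: Throughout $m\ge 2$, and all tensors are real. $T(m,n)$ is the set of real $m$th-order $n$-dimensional tensors $\mathcal{A}=(a_{i_1i_2\ldots i_m})$, $1\le i_1,\ldots,i_m\le n$. For $\mathbf{x}\in\mathbb{R}^n$, $\mathcal{A}\mathbf{x}^{m-1}\in\mathbb{R}^n$ has components $(\mathcal{A}\mathbf{x}^{m-1})_i=\sum_{i_2,\ldots,i_m=1}^n a_{ii_2\ldots i_m}x_{i_2}\cdots x_{i_m}$; $\mathbf{x}^{[m-1]}=(x_1^{m-1},\ldots,x_n^{m-1})^T$; $|\mathbf{x}|^{[m-1]}=(|x_1|^{m-1},\ldots,|x_n|^{m-1})^T$. Vector inequalities are componentwise, and a vector is nonnegative if all its components are nonnegative. $\mathcal{I}\in T(m,n)$ is the unit tensor, with entries $1$ if $i_1=\cdots=i_m$ and $0$ otherwise. $\mathcal{B}\ge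 0$ means all entries of $\mathcal{B}$ are nonnegative. A scalar $\lambda\in\mathbb{R}$ is an eigenvalue of $\mathcal{B}$ if $\mathcal{B}\mathbf{x}^{m-1}=\lambda\mathbf{x}^{[m-1]}$ for some nonzero $\mathbf{x}\in\mathbb{R}^n$, and the spectral radius is $\rho(\mathcal{B})=\max\{|\lambda| : \lambda \text{ is an eigenvalue of } \mathcal{B}\}$. *)

theory Defs
  imports "HOL-Analysis.Analysis"
begin

text \<open>An entry of an order-\<open>m\<close> tensor is indexed by a list
  \<open>[i\<^sub>1, \<dots>, i\<^sub>m]\<close> over the finite index type \<open>'n\<close> (so \<open>n = CARD('n)\<close>);
  values at lists of any other length are fixed to \<open>0\<close>, so that equality of functions is
  equality of tensors.\<close>

definition tensors :: "nat \<Rightarrow> ('n::finite list \<Rightarrow> real) set" where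
  "tensors m = {A. \<forall>ks. length ks \<noteq> m \<longrightarrow> A ks = 0}"

definition unit_tensor :: "nat \<Rightarrow> 'n::finite list \<Rightarrow> real" where
  "unit_tensor m ks = (if \<exists>i. ks = replicate m i then 1 else 0)"

definition tensor_apply :: "nat \<Rightarrow> ('n::finite list \<Rightarrow> real) \<Rightarrow> real ^ 'n \<Rightarrow> real ^ 'n" where
  "tensor_apply m A x =
    (\<chi> i. \<Sum>ks | length ks = m - 1. A (i # ks) * (\<Prod>k\<leftarrow>ks. x $ k))"

definition vec_power :: "real ^ 'n \<Rightarrow> nat \<Rightarrow> real ^ 'n::finite" where
  "vec_power x k = (\<chi> i. (x $ i) ^ k)"

definition tensor_eigenvalue :: "nat \<Rightarrow> ('n::finite list \<Rightarrow> real) \<Rightarrow> real \<Rightarrow> bool" where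
  "tensor_eigenvalue m B \<mu> \<longleftrightarrow>
    (\<exists>x. x \<noteq> 0 \<and> tensor_apply m B x = \<mu> *\<^sub>R vec_power x (m - 1))"

text \<open>The maximum is taken with \<open>Greatest\<close> rather than \<open>Max\<close>, since \<open>Max\<close> is
  meaningful only for sets known to be finite.\<close>

definition spectral_radius :: "nat \<Rightarrow> ('n::finite list \<Rightarrow> real) \<Rightarrow> real" where
  "spectral_radius m B = (GREATEST r. \<exists>\<mu>. tensor_eigenvalue m B \<mu> \<and> r = \<bar>\<mu>\<bar>)"

end

theory Submission
  imports Defs
begin

text \<open>Put \<open>r = c - 1\<close> and \<open>k = m - 1\<close>. On nonnegative vectors the absolute value is
  invisible, so a nonnegative solution is a nonnegative \<open>x\<close> with
  \<open>r x\<^sub>i\<^sup>k = (B x\<^sup>k + b)\<^sub>i\<close> for all \<open>i\<close>, while the vector \<open>v\<close> satisfies the same system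
  with \<open>\<ge>\<close> in place of \<open>=\<close>.

  If \<open>r > 0\<close>, taking \<open>k\<close>-th roots turns the system into a fixed point equation \<open>G x = x\<close>.
  Nonnegativity of the entries of \<open>B\<close> makes \<open>G\<close> monotone on the nonnegative orthant, nonnegativity
  of \<open>b\<close> gives \<open>0 \<le> G 0\<close>, and the hypothesis on \<open>v\<close> reads \<open>G v \<le> v\<close>. Hence \<open>G\<close> maps the order
  interval from \<open>0\<close> to \<open>v\<close> monotonically into itself, and the Knaster--Tarski argument
  (\<open>monotone_fixpoint_between\<close>) yields a fixed point.

  If \<open>r \<le> 0\<close>, then \<open>0 \<le> b \<le> r v\<^sup>[\<^sup>k\<^sup>] - B v\<^sup>k \<le> 0\<close>, so \<open>b = 0\<close> and \<open>x = 0\<close> is a solution.\<close>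

text \<open>The Knaster--Tarski theorem for an order interval: the infimum of the points that \<open>G\<close>
  moves down is a fixed point, by the usual two inequalities.\<close>

lemma monotone_fixpoint_between:
  fixes G :: "'a::conditionally_complete_lattice \<Rightarrow> 'a"
  assumes "u \<le> v" "u \<le> G u" "G v \<le> v"
    and mono: "\<And>x y. u \<le> x \<Longrightarrow> x \<le> y \<Longrightarrow> y \<le> v \<Longrightarrow> G x \<le> G y"
  shows "\<exists>x. u \<le> x \<and> x \<le> v \<and> G x = x"
proof -
  define S where "S = {x. u \<le> x \<and> x \<le> v \<and> G x \<le> x}"
  have "v \<in> S" using assms by (simp add: S_def)
  have lower: "Inf S \<le> x" if "x \<in> S" for x
    by (rule cInf_lower[OF that]) (auto simp: S_def)
  have greatest: "z \<le> Inf S" if "\<And>x. x \<in> S \<Longrightarrow> z \<le> x" for z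
    using \<open>v \<in> S\<close> that by (intro cInf_greatest) auto
  have u: "u \<le> Inf S" by (rule greatest) (simp add: S_def)
  have v: "Inf S \<le> v" by (rule lower) fact
  have down: "G (Inf S) \<le> Inf S"
  proof (rule greatest)
    fix x assume x: "x \<in> S"
    have "G (Inf S) \<le> G x"
      using x u lower[OF x] by (intro mono) (auto simp: S_def)
    also have "\<dots> \<le> x" using x by (simp add: S_def)
    finally show "G (Inf S) \<le> x" .
  qed
  have "u \<le> G (Inf S)"
    using assms(2) mono[OF order_refl u v] by (rule order_trans)
  then have "G (Inf S) \<in> S"
    using down v mono[OF _ down v] by (auto simp: S_def)
  then have "G (Inf S) = Inf S"
    using down lower by (blast intro: order_antisym)
  then show ?thesis using u v by blast
qed

lemma tensor_apply_nonneg: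
  fixes B :: "'n::finite list \<Rightarrow> real"
  assumes "m \<ge> 1" "\<And>ks. length ks = m \<Longrightarrow> 0 \<le> B ks" "0 \<le> x"
  shows "0 \<le> tensor_apply m B x"
  using assms
  by (auto simp: tensor_apply_def less_eq_vec_def intro!: sum_nonneg mult_nonneg_nonneg prod_list_nonneg)

lemma prod_list_map_mono:
  fixes f g :: "'a \<Rightarrow> 'b::linordered_semidom"
  assumes "\<And>k. k \<in> set ks \<Longrightarrow> 0 \<le> f k \<and> f k \<le> g k"
  shows "0 \<le> (\<Prod>k\<leftarrow>ks. f k) \<and> (\<Prod>k\<leftarrow>ks. f k) \<le> (\<Prod>k\<leftarrow>ks. g k)"
  using assms
proof (induction ks)
  case (Cons a ks)
  then have "0 \<le> f a" "f a \<le> g a"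
    "0 \<le> (\<Prod>k\<leftarrow>ks. f k)" "(\<Prod>k\<leftarrow>ks. f k) \<le> (\<Prod>k\<leftarrow>ks. g k)"
    by auto
  then show ?case by (auto intro: mult_mono)
qed simp

lemma tensor_apply_mono:
  fixes B :: "'n::finite list \<Rightarrow> real"
  assumes "m \<ge> 1" "\<And>ks. length ks = m \<Longrightarrow> 0 \<le> B ks" "0 \<le> x" "x \<le> y"
  shows "tensor_apply m B x \<le> tensor_apply m B y"
proof -
  have "(\<Prod>k\<leftarrow>ks. x $ k) \<le> (\<Prod>k\<leftarrow>ks. y $ k)" for ks
    using assms(3,4) prod_list_map_mono[of ks "($) x" "($) y"] by (simp add: less_eq_vec_def)
  then show ?thesis
    using assms(1,2) by (auto simp: tensor_apply_def less_eq_vec_def intro!: sum_mono mult_left_mono)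
qed

lemma tensor_apply_zero:
  fixes B :: "'n::finite list \<Rightarrow> real"
  assumes "m \<ge> 2"
  shows "tensor_apply m B 0 = 0"
proof -
  have "B (i # ks) * (\<Prod>k\<leftarrow>ks. (0 :: real ^ 'n) $ k) = 0"
    if "length ks = m - 1" for i ks
    using that assms by (cases ks) auto
  then show ?thesis
    by (auto simp: tensor_apply_def vec_eq_iff intro!: sum.neutral)
qed

text \<open>In row \<open>i\<close> of the unit tensor only the index list consisting of copies of \<open>i\<close> contributes.
  For \<open>m = 0\<close> this would fail: \<open>i # ks\<close> then never has length \<open>m\<close>.\<close>

lemma tensor_apply_unit_diff:
  fixes B :: "'n::finite list \<Rightarrow> real"
  assumes "m \<ge> 1"
  shows "tensor_apply m (\<lambda>ks. s * unit_tensor m ks - B ks) x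
    = s *\<^sub>R vec_power x (m - 1) - tensor_apply m B x"
proof -
  obtain k where m: "m = Suc k" using assms by (cases m) auto
  have unit: "unit_tensor m (i # ks) = (if ks = replicate k i then 1 else 0)"
    for i :: 'n and ks
    by (auto simp: unit_tensor_def m)
  have fin: "finite {ks :: 'n list. length ks = k}"
    using finite_lists_length_eq[of "UNIV :: 'n set" k] by simp
  have "(\<Sum>ks | length ks = k. s * unit_tensor m (i # ks) * (\<Prod>j\<leftarrow>ks. x $ j))
      = s * (x $ i) ^ k" for i
  proof -
    have "(\<Sum>ks | length ks = k. s * unit_tensor m (i # ks) * (\<Prod>j\<leftarrow>ks. x $ j))
      = (\<Sum>ks | length ks = k. if ks = replicate k i then s * (\<Prod>j\<leftarrow>ks. x $ j) else 0)"
      by (rule sum.cong) (auto simp: unit)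
    also have "\<dots> = s * (\<Prod>j\<leftarrow>replicate k i. x $ j)"
      using fin by (simp add: sum.delta)
    also have "\<dots> = s * (x $ i) ^ k" by (simp add: prod_list_replicate)
    finally show ?thesis .
  qed
  then show ?thesis
    by (simp add: m vec_eq_iff tensor_apply_def vec_power_def left_diff_distrib sum_subtractf)
qed

text \<open>For \<open>r > 0\<close> the system is a fixed point equation for componentwise \<open>k\<close>-th roots of
  \<open>(F x + b) / r\<close>. These roots are monotone in \<open>x\<close> and, since \<open>k > 0\<close>, invertible on
  nonnegative reals, so a nonnegative supersolution bounds an order interval that they preserve.\<close>

lemma solution_below_supersolution:
  fixes F :: "real ^ 'n::finite \<Rightarrow> real ^ 'n"
  assumes "k > 0" "r > 0" "0 \<le> b" "0 \<le> v"
    and super: "F v + b \<le> r *\<^sub>R vec_power v k"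
    and nonneg: "\<And>x. 0 \<le> x \<Longrightarrow> 0 \<le> F x"
    and mono: "\<And>x y. 0 \<le> x \<Longrightarrow> x \<le> y \<Longrightarrow> F x \<le> F y"
  shows "\<exists>x. 0 \<le> x \<and> x \<le> v \<and> r *\<^sub>R vec_power x k = F x + b"
proof -
  define G where "G x = (\<chi> i. root k ((F x + b) $ i / r))" for x
  have rhs: "0 \<le> (F x + b) $ i / r" if "0 \<le> x" for x i
    using nonneg[OF that] \<open>0 \<le> b\<close> \<open>r > 0\<close> by (auto simp: less_eq_vec_def)
  have "\<exists>x. 0 \<le> x \<and> x \<le> v \<and> G x = x"
  proof (rule monotone_fixpoint_between)
    show "0 \<le> G 0"
      using rhs[of 0] \<open>k > 0\<close> by (simp add: G_def less_eq_vec_def)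
    show "G v \<le> v"
      unfolding less_eq_vec_def
    proof
      fix i
      have "(F v + b) $ i / r \<le> (v $ i) ^ k"
        using super \<open>r > 0\<close> by (simp add: less_eq_vec_def vec_power_def field_simps)
      then have "root k ((F v + b) $ i / r) \<le> root k ((v $ i) ^ k)"
        using \<open>k > 0\<close> by simp
      also have "\<dots> = v $ i"
        using \<open>k > 0\<close> \<open>0 \<le> v\<close> by (simp add: less_eq_vec_def real_root_power_cancel)
      finally show "G v $ i \<le> v $ i" by (simp add: G_def)
    qed
    show "G x \<le> G y" if "0 \<le> x" "x \<le> y" for x y
      using mono[OF that] \<open>k > 0\<close> \<open>r > 0\<close>
      by (auto simp: G_def less_eq_vec_def intro!: divide_right_mono)
  qed fact
  then obtain x where x: "0 \<le> x" "x \<le> v" "G x = x" by blast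
  have "r *\<^sub>R vec_power x k = F x + b"
    unfolding vec_eq_iff
  proof
    fix i
    have "(x $ i) ^ k = (G x $ i) ^ k" by (simp add: x(3))
    also have "\<dots> = (F x + b) $ i / r"
      using rhs[OF x(1), of i] \<open>k > 0\<close> by (simp add: G_def)
    finally show "(r *\<^sub>R vec_power x k) $ i = (F x + b) $ i"
      using \<open>r > 0\<close> by (simp add: vec_power_def field_simps)
  qed
  with x show ?thesis by blast
qed

theorem theorem3p6:
  fixes m :: nat and c :: real
    and A B :: "'n::finite list \<Rightarrow> real"
    and b :: "real ^ 'n"
  assumes "m \<ge> 2"
    and "0 \<le> b"
    and "A \<in> tensors m" and "B \<in> tensors m"
    and "\<forall>ks. length ks = m \<longrightarrow> 0 \<le> B ks"
    and "A = (\<lambda>ks. c * unit_tensor m ks - B ks)"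
    and "c = spectral_radius m B + 1"
    and "\<exists>v. 0 \<le> v \<and> b \<le> tensor_apply m (\<lambda>ks. A ks - unit_tensor m ks) v"
  shows "\<exists>x. 0 \<le> x \<and> tensor_apply m A x - vec_power \<bar>x\<bar> (m - 1) = b"
proof -
  define r where "r = c - 1"
  have m: "m \<ge> 1" "m - 1 > 0" using \<open>m \<ge> 2\<close> by auto
  have nonneg: "0 \<le> tensor_apply m B x" if "0 \<le> x" for x
    using tensor_apply_nonneg[OF m(1) _ that, of B] assms(5) by blast
  have lhs: "tensor_apply m A x - vec_power \<bar>x\<bar> (m - 1)
      = r *\<^sub>R vec_power x (m - 1) - tensor_apply m B x" if "0 \<le> x" for x
    using that m(1)
    by (simp add: assms(6) tensor_apply_unit_diff r_def abs_of_nonneg algebra_simps)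
  have shifted: "(\<lambda>ks. A ks - unit_tensor m ks) = (\<lambda>ks. r * unit_tensor m ks - B ks)"
    by (simp add: assms(6) r_def fun_eq_iff algebra_simps)
  obtain v where "0 \<le> v" and v: "b \<le> r *\<^sub>R vec_power v (m - 1) - tensor_apply m B v"
    using assms(8) m(1) by (auto simp: shifted tensor_apply_unit_diff)
  have "\<exists>x. 0 \<le> x \<and> r *\<^sub>R vec_power x (m - 1) - tensor_apply m B x = b"
  proof (cases "r > 0")
    case True
    have "tensor_apply m B v + b \<le> r *\<^sub>R vec_power v (m - 1)"
      using v by (simp add: algebra_simps)
    then have "\<exists>x. 0 \<le> x \<and> x \<le> v \<and>
        r *\<^sub>R vec_power x (m - 1) = tensor_apply m B x + b"
      using m True \<open>0 \<le> b\<close> \<open>0 \<le> v\<close> assms(5)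
      by (intro solution_below_supersolution nonneg tensor_apply_mono) auto
    then show ?thesis by (auto simp: diff_eq_eq add.commute)
  next
    case False
    have "r *\<^sub>R vec_power v (m - 1) \<le> 0"
      using False \<open>0 \<le> v\<close>
      by (auto simp: less_eq_vec_def vec_power_def intro!: mult_nonpos_nonneg)
    with v nonneg[OF \<open>0 \<le> v\<close>] have "b \<le> 0"
      by (intro order_trans[OF v]) (simp add: order_trans)
    with \<open>0 \<le> b\<close> have b: "b = 0" by (rule order_antisym[rotated])
    show ?thesis
      using m(2) b \<open>m \<ge> 2\<close>
      by (intro exI[of _ 0]) (simp add: tensor_apply_zero vec_power_def vec_eq_iff)
  qed
  then show ?thesis using lhs by metis
qed

end
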